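(* Let $G=(I,A,\iota,(u_i)_{i\in I})$ be a game with infinite past. Assume that along each run at least two players are active infinitely often. Let $(s,r)$ be an equilibrium of $G$, and let $\Omega$ be the segment containing $r$. For each player $i\in I$ let $\widehat s_i$ be a strategy such that (a) $r$ is consistent with $\widehat s_i$, and (b) every run $r'\notin\Omega$ along which player $i$ is active infinitely often is not consistent with $\widehat s_i$; put $\widehat s=(\widehat s_i)_{i\in I}$. Let $s^*$ be the strategy profile that coincides with $\widehat s$, except that if the play follows $r$ until some stage $n$ in which a player deviates from $r$, then $s^*$ switches to $s$ for the remaining stages $n+1,\ldots,-1,0$ (that is, $s^*$ coincides with $s$ at every position $p\in P_\Omega$ that is not of the form $r_{<n}$, $n\in\mathbb{Z}_0$, and coincides with $\widehat s$ at all other positions). Then $s^*$ is a strong equilibrium of $G$, and $r$ is the corresponding equilibrium run, i.e., $R(s^* )=\{r\}$.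
   Context: Let $\mathbb{Z}_0=\{\ldots,-2,-1,0\}$ and, for $n\in\mathbb{Z}_0$, $\mathbb{Z}_n=\{\ldots,n-1,n\}$. A game with infinite past is a tuple $G=(I,A,\iota,(u_i)_{i\in I})$ where $I$ is a nonempty finite set of players; $A$ is a finite set of actions with $|A|\ge 2$; a position in stage $n\in\mathbb{Z}_0$ is a sequence $p_n=(\ldots,a_{n-2},a_{n-1})\in P_n:=A^{\mathbb{Z}_{n-1}}$, and $P=\bigcup_{n\in\mathbb{Z}_0}P_n$ (a disjoint union); a run is a sequence $r=(\ldots,a_{-1},a_0)\in R:=A^{\mathbb{Z}_0}$; $\iota:P\to I$ assigns to each position the player who controls it (the active player); $u_i:R\to\mathbb{R}$ is a bounded payoff function for each $i\in I$. For a run $r=(\ldots,a_{-1},a_0)$, $r_{<n}=(\ldots,a_{n-2},a_{n-1})$ is the position in stage $n$ along $r$. A strategy of player $i$ is a map $s_i:\{p\in P:\iota(p)=i\}\to A$; a strategy profile is $s=(s_i)_{i\in I}$. A run $r=(\ldots,a_{-1},a_0)$ is consistent with $s_i$ if $a_n=s_i(r_{<n})$ for every $n\in\mathbb{Z}_0$ with $\iota(r_{<n})=i$; it is consistent with $s$ if it is consistent with every $s_i$. $R(s)$ is the set of runs consistent with $s$. Player $i$ is active infinitely often along $r$ if $\{n\in\mathbb{Z}_0:\iota(r_{<n})=i\}$ is infinite. Segments are the equivalence classes of the relation on $R$: $r\sim r'$ iff there is $n\in\mathbb{Z}_0$ with $r_{<n}=r'_{<n}$. For a segment $\Omega$, $P_\Omega=\{r_{<n}: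 r\in\Omega,\ n\in\mathbb{Z}_0\}$. For a position $p_n\in P_n$, the subgame $G[p_n]$ is the finite game played in stages $n,\ldots,-1,0$ that arises when the actions up to stage $n-1$ are given by $p_n$; a strategy profile $s$ induces a strategy profile $s[p_n]$ in it. A traditional equilibrium of $G[p_n]$ is a pure Nash equilibrium of this finite game. Equilibrium: a pair $(s,r)$, with $s$ a strategy profile and $r\in R(s)$, such that for each $n\in\mathbb{Z}_0$, $s[r_{<n}]$ is a traditional equilibrium of $G[r_{<n}]$. Strong equilibrium: a strategy profile $s$ with $R(s)=\{r\}$ for some run $r$ such that for each player $i$, each strategy $s'_i$ of player $i$ and each $r'\in R(s'_i,s_{-i})$ we have $u_i(r')\le u_i(r)$. *)

theory Defs
  imports "HOL-Analysis.Analysis"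
begin

text \<open>
  Time is counted backwards from the last stage: the stage \<open>n \<in> {\<dots>, -2, -1, 0}\<close> is represented
  by the natural number \<open>k = -n\<close>.  The run \<open>(\<dots>, a\<^sub>-\<^sub>1, a\<^sub>0)\<close> is the function \<open>r\<close> with
  \<open>r k = a\<^sub>-\<^sub>k\<close>.  A position in stage \<open>-k\<close> is a pair \<open>(k, q)\<close>, where \<open>q j\<close> is the action that was
  taken \<open>j + 1\<close> stages before stage \<open>-k\<close>; the first component makes the union of the sets of
  positions of the different stages disjoint.
\<close>

type_synonym 'a run = "nat \<Rightarrow> 'a"
type_synonym 'a position = "nat \<times> (nat \<Rightarrow> 'a)"

text \<open>
  The sets of players and of actions are the types \<open>'i\<close> and \<open>'a\<close>, which are required to be of
  class \<open>finite\<close>.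
\<close>

record ('i, 'a) past_game =
  active :: "'a position \<Rightarrow> 'i"
  payoff :: "'i \<Rightarrow> 'a run \<Rightarrow> real"

definition game_with_infinite_past :: "('i::finite, 'a::finite) past_game \<Rightarrow> bool" where
  "game_with_infinite_past G \<longleftrightarrow>
     2 \<le> CARD('a) \<and> (\<forall>i. bounded (range (payoff G i)))"

definition position_along :: "'a run \<Rightarrow> nat \<Rightarrow> 'a position" where
  "position_along r k = (k, \<lambda>j. r (Suc k + j))"

definition active_infinitely_often :: "('i, 'a) past_game \<Rightarrow> 'i \<Rightarrow> 'a run \<Rightarrow> bool" where
  "active_infinitely_often G i r \<longleftrightarrow> infinite {k. active G (position_along r k) = i}"

text \<open>
  Strategies are total functions on positions; the values of a strategy of player \<open>i\<close> at
  positions not controlled by \<open>i\<close> are never used.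
\<close>

type_synonym 'a strategy = "'a position \<Rightarrow> 'a"
type_synonym ('i, 'a) profile = "'i \<Rightarrow> 'a strategy"

definition consistent :: "('i, 'a) past_game \<Rightarrow> 'i \<Rightarrow> 'a strategy \<Rightarrow> 'a run \<Rightarrow> bool" where
  "consistent G i t r \<longleftrightarrow>
     (\<forall>k. active G (position_along r k) = i \<longrightarrow> r k = t (position_along r k))"

definition consistent_runs :: "('i, 'a) past_game \<Rightarrow> ('i, 'a) profile \<Rightarrow> 'a run set" where
  "consistent_runs G s = {r. \<forall>i. consistent G i (s i) r}"

definition same_segment :: "('a run \<times> 'a run) set" where
  "same_segment = {(r, r'). \<exists>k. position_along r k = position_along r' k}"

definition segments :: "'a run set set" where
  "segments = UNIV // same_segment"

definition segment_positions :: "'a run set \<Rightarrow> 'a position set" where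
  "segment_positions \<Omega> = {position_along r k | r k. r \<in> \<Omega>}"

text \<open>
  Finite games with perfect information: a history is the list of the actions taken so far, in
  chronological order, and a play is a history of length \<open>horizon\<close>.
\<close>

record ('i, 'a) finite_game =
  horizon :: nat
  mover :: "'a list \<Rightarrow> 'i"
  reward :: "'i \<Rightarrow> 'a list \<Rightarrow> real"

primrec history ::
  "('i, 'a) finite_game \<Rightarrow> ('i \<Rightarrow> 'a list \<Rightarrow> 'a) \<Rightarrow> nat \<Rightarrow> 'a list" where
  "history \<Gamma> \<sigma> 0 = []"
| "history \<Gamma> \<sigma> (Suc m) =
     history \<Gamma> \<sigma> m @ [\<sigma> (mover \<Gamma> (history \<Gamma> \<sigma> m)) (history \<Gamma> \<sigma> m)]"

definition outcome :: "('i, 'a) finite_game \<Rightarrow> ('i \<Rightarrow> 'a list \<Rightarrow> 'a) \<Rightarrow> 'a list" where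
  "outcome \<Gamma> \<sigma> = history \<Gamma> \<sigma> (horizon \<Gamma>)"

definition nash_equilibrium :: "('i, 'a) finite_game \<Rightarrow> ('i \<Rightarrow> 'a list \<Rightarrow> 'a) \<Rightarrow> bool" where
  "nash_equilibrium \<Gamma> \<sigma> \<longleftrightarrow>
     (\<forall>i \<tau>. reward \<Gamma> i (outcome \<Gamma> (\<sigma>(i := \<tau>))) \<le> reward \<Gamma> i (outcome \<Gamma> \<sigma>))"

text \<open>
  Since the most recent action has index \<open>0\<close>, appending one action \<open>a\<close> to a past \<open>q\<close> yields
  \<open>case_nat a q\<close>.  The subgame at a position in stage \<open>-k\<close> consists of the \<open>k + 1\<close> stages
  \<open>-k, \<dots>, 0\<close>; appending all \<open>k + 1\<close> actions of a play to the past yields a run.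
\<close>

definition append_actions :: "(nat \<Rightarrow> 'a) \<Rightarrow> 'a list \<Rightarrow> (nat \<Rightarrow> 'a)" where
  "append_actions q h = fold case_nat h q"

definition position_after :: "'a position \<Rightarrow> 'a list \<Rightarrow> 'a position" where
  "position_after p h = (fst p - length h, append_actions (snd p) h)"

definition subgame :: "('i, 'a) past_game \<Rightarrow> 'a position \<Rightarrow> ('i, 'a) finite_game" where
  "subgame G p =
     \<lparr> horizon = Suc (fst p),
       mover = (\<lambda>h. active G (position_after p h)),
       reward = (\<lambda>i h. payoff G i (append_actions (snd p) h)) \<rparr>"

definition induced_profile ::
  "('i, 'a) profile \<Rightarrow> 'a position \<Rightarrow> ('i \<Rightarrow> 'a list \<Rightarrow> 'a)" where
  "induced_profile s p = (\<lambda>i h. s i (position_after p h))"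

definition equilibrium :: "('i, 'a) past_game \<Rightarrow> ('i, 'a) profile \<Rightarrow> 'a run \<Rightarrow> bool" where
  "equilibrium G s r \<longleftrightarrow>
     r \<in> consistent_runs G s \<and>
     (\<forall>k. nash_equilibrium (subgame G (position_along r k))
                           (induced_profile s (position_along r k)))"

definition strong_equilibrium :: "('i, 'a) past_game \<Rightarrow> ('i, 'a) profile \<Rightarrow> bool" where
  "strong_equilibrium G s \<longleftrightarrow>
     (\<exists>r. consistent_runs G s = {r} \<and>
          (\<forall>i t. \<forall>r' \<in> consistent_runs G (s(i := t)). payoff G i r' \<le> payoff G i r))"

definition switch_profile ::
  "('i, 'a) profile \<Rightarrow> ('i, 'a) profile \<Rightarrow> 'a run \<Rightarrow> 'a run set \<Rightarrow> ('i, 'a) profile" where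
  "switch_profile s s_hat r \<Omega> =
     (\<lambda>i p. if p \<in> segment_positions \<Omega> \<and> p \<notin> range (position_along r)
            then s i p else s_hat i p)"

lemma equiv_same_segment: "equiv UNIV (same_segment :: ('a run \<times> 'a run) set)"
proof -
  have mono: "position_along r m = position_along r' m"
    if "position_along r k = position_along r' k" "k \<le> m" for r r' :: "'a run" and k m
  proof -
    have "r (Suc k + j) = r' (Suc k + j)" for j
      using that(1) by (auto simp: position_along_def dest: fun_cong)
    from this[of "m - k + _"] show ?thesis
      using that(2) by (auto simp: position_along_def)
  qed
  show ?thesis
  proof (rule equivI)
    show "trans (same_segment :: ('a run \<times> 'a run) set)"
    proof (rule transI)
      fix x y z :: "'a run"
      assume "(x, y) \<in> same_segment" "(y, z) \<in> same_segment"
      then obtain k m where "position_along x k = position_along y k"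
        "position_along y m = position_along z m"
        by (auto simp: same_segment_def)
      then have "position_along x (max k m) = position_along z (max k m)"
        using mono[of x k y "max k m"] mono[of y m z "max k m"] by simp
      then show "(x, z) \<in> same_segment"
        by (auto simp: same_segment_def)
    qed
  qed (auto simp: refl_on_def sym_def same_segment_def eq_commute)
qed

lemma append_actions_along_run:
  "append_actions (\<lambda>j. r (m + j)) (map r (rev [0..<m])) = r"
proof (induction m)
  case (Suc m)
  have "case_nat (r m) (\<lambda>j. r (Suc m + j)) = (\<lambda>j. r (m + j))"
    by (auto simp: fun_eq_iff split: nat.split)
  with Suc show ?case
    by (simp add: append_actions_def)
qed (simp add: append_actions_def)

end

theory Submission
  imports Defs
begin

text \<open>
  Suppose all players other than \<open>i\<close> follow \<open>s*\<close> along \<open>r'\<close>.  Some player other than \<open>i\<close> is active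
  infinitely often along \<open>r'\<close>, so (b) forces \<open>r'\<close> into the segment \<open>\<Omega>\<close>.  Hence, if \<open>r'\<close> differs
  from \<open>r\<close>, there is a first stage at which it leaves \<open>r\<close>.  By (a) only \<open>i\<close> can have deviated
  there.  Applied to two different players, this shows that \<open>r\<close> is the only run consistent with
  \<open>s*\<close>.  From the deviation on the opponents of \<open>i\<close> play according to \<open>s\<close>, so \<open>r'\<close> is the outcome
  of a unilateral deviation from \<open>s\<close> in the subgame at that position, which is not profitable.
\<close>

lemma same_segment_class:
  assumes "\<Omega> \<in> segments" and "r \<in> \<Omega>"
  shows "r' \<in> \<Omega> \<longleftrightarrow> (\<exists>k. position_along r k = position_along r' k)"
proof -
  from assms(1) obtain x where x: "\<Omega> = same_segment `` {x}"
    by (auto simp: segments_def elim: quotientE)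
  with assms(2) have "\<Omega> = same_segment `` {r}"
    using equiv_class_eq[OF equiv_same_segment, of x r] by simp
  then show ?thesis
    by (simp add: same_segment_def)
qed

lemma position_along_eq_iff:
  "position_along r k = position_along r' k' \<longleftrightarrow> k = k' \<and> (\<forall>j>k. r j = r' j)"
  by (auto simp: position_along_def fun_eq_iff less_iff_Suc_add)

text \<open>A position carries its stage, so two positions can coincide only at the same stage.
  Hence the answer does not depend on \<open>k\<close>: a run outside \<Omega> never meets
  \<open>segment_positions \<Omega>\<close>, and along it the switched profile is
  \<open>s_hat\<close>.\<close>

lemma position_along_in_segment_positions_iff:
  assumes "\<Omega> \<in> segments"
  shows "position_along r' k \<in> segment_positions \<Omega> \<longleftrightarrow> r' \<in> \<Omega>"
proof
  assume "position_along r' k \<in> segment_positions \<Omega>"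
  then obtain r k' where "r \<in> \<Omega>" and eq: "position_along r' k = position_along r k'"
    by (auto simp: segment_positions_def)
  moreover from eq have "position_along r k = position_along r' k"
    by (simp add: position_along_eq_iff)
  ultimately show "r' \<in> \<Omega>"
    using same_segment_class[OF assms] by blast
qed (auto simp: segment_positions_def)

text \<open>Two such runs differ at finitely many indices. As time is counted backwards, the
  earliest difference is the largest of these indices.\<close>

lemma same_segment_first_difference:
  assumes "position_along r k = position_along r' k" and "r' \<noteq> r"
  obtains m where "r' m \<noteq> r m" and "position_along r m = position_along r' m"
proof
  let ?D = "{j. r' j \<noteq> r j}"
  have "?D \<subseteq> {..k}"
    using assms(1) by (force simp: position_along_eq_iff not_less[symmetric])
  then have fin: "finite ?D"
    by (rule finite_subset) simp
  moreover have "?D \<noteq> {}"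
    using assms(2) by auto
  ultimately show "r' (Max ?D) \<noteq> r (Max ?D)"
    using Max_in by blast
  have "r j = r' j" if "Max ?D < j" for j
  proof (rule ccontr)
    assume "r j \<noteq> r' j"
    then have "j \<le> Max ?D"
      by (intro Max_ge[OF fin]) simp
    with that show False
      by simp
  qed
  then show "position_along r (Max ?D) = position_along r' (Max ?D)"
    unfolding position_along_eq_iff by blast
qed

lemma append_actions_segment:
  assumes "k \<le> l"
  shows "append_actions (\<lambda>j. r (l + j)) (map r (rev [k..<l])) = (\<lambda>j. r (k + j))"
proof -
  \<comment> \<open>This is the case \<open>k = 0\<close> for the run shifted by
    \<open>k\<close>.\<close>
  have "append_actions (\<lambda>j. (\<lambda>j. r (k + j)) (l - k + j)) (map (\<lambda>j. r (k + j)) (rev [0..<l - k]))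
      = (\<lambda>j. r (k + j))"
    by (rule append_actions_along_run)
  moreover have "map (\<lambda>j. r (k + j)) (rev [0..<l - k]) = map r (rev [k..<l])"
    using assms by (intro nth_equalityI) (auto simp: rev_nth)
  ultimately show ?thesis
    using assms by simp
qed

lemma position_after_along_run:
  assumes "n \<le> m"
  shows "position_after (position_along r m) (map r (rev [Suc m - n..<Suc m]))
       = position_along r (m - n)"
proof -
  have "append_actions (\<lambda>j. r (Suc m + j)) (map r (rev [Suc m - n..<Suc m]))
      = (\<lambda>j. r (Suc m - n + j))"
    by (rule append_actions_segment) simp
  then show ?thesis
    using assms by (simp add: position_after_def position_along_def Suc_diff_le del: upt_Suc)
qed

lemma outcome_along_run:
  assumes "\<And>k. k \<le> m \<Longrightarrow> r k = s (active G (position_along r k)) (position_along r k)"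
  shows "outcome (subgame G (position_along r m)) (induced_profile s (position_along r m))
       = map r (rev [0..<Suc m])"
proof -
  have "history (subgame G (position_along r m)) (induced_profile s (position_along r m)) n
      = map r (rev [Suc m - n..<Suc m])" if "n \<le> Suc m" for n
    using that
  proof (induction n)
    case (Suc n)
    then have "n \<le> m"
      by simp
    \<comment> \<open>The next move has index \<open>m - n\<close>, the least one so far; reversal
      puts it at the end of the history.\<close>
    then have "[m - n..<Suc m] = (m - n) # [Suc m - n..<Suc m]"
      by (simp add: upt_conv_Cons Suc_diff_le del: upt_Suc)
    then show ?case
      using Suc assms[of "m - n"] \<open>n \<le> m\<close>
      by (simp add: subgame_def induced_profile_def position_after_along_run del: upt_Suc)
  qed simp
  from this[of "Suc m"] show ?thesis
    by (simp add: outcome_def subgame_def position_along_def del: upt_Suc)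
qed

lemma reward_along_run:
  "reward (subgame G (position_along r m)) i (map r (rev [0..<Suc m])) = payoff G i r"
  using append_actions_along_run[of r "Suc m"]
  by (simp add: subgame_def position_along_def del: upt_Suc)

lemma consistent_runs_iff:
  "r \<in> consistent_runs G s \<longleftrightarrow>
     (\<forall>k. r k = s (active G (position_along r k)) (position_along r k))"
  by (auto simp: consistent_runs_def consistent_def)

text \<open>Before the subgame starts, \<open>r'\<close> shares the past of \<open>r\<close>, so
  only its moves at indices up to \<open>m\<close> must obey the deviation. Then \<open>r\<close>
  and \<open>r'\<close> are the two plays that the Nash inequality compares.\<close>

lemma nash_equilibrium_subgame_payoff:
  assumes "nash_equilibrium (subgame G (position_along r m)) (induced_profile s (position_along r m))"
    and "r \<in> consistent_runs G s"
    and "position_along r m = position_along r' m"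
    and "\<And>k. k \<le> m \<Longrightarrow> r' k = (s(i := t)) (active G (position_along r' k)) (position_along r' k)"
  shows "payoff G i r' \<le> payoff G i r"
proof -
  let ?p = "position_along r m"
  \<comment> \<open>The deviation in the finite game is the one that \<open>t\<close> induces
    there.\<close>
  have "(induced_profile s ?p)(i := \<lambda>h. t (position_after ?p h)) = induced_profile (s(i := t)) ?p"
    by (auto simp: induced_profile_def fun_eq_iff)
  with assms(1) have "reward (subgame G ?p) i (outcome (subgame G ?p) (induced_profile (s(i := t)) ?p))
      \<le> reward (subgame G ?p) i (outcome (subgame G ?p) (induced_profile s ?p))"
    unfolding nash_equilibrium_def by metis
  moreover have "outcome (subgame G ?p) (induced_profile (s(i := t)) ?p) = map r' (rev [0..<Suc m])"
    using outcome_along_run[of m r' "s(i := t)" G] assms(3,4) by simp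
  moreover have "outcome (subgame G ?p) (induced_profile s ?p) = map r (rev [0..<Suc m])"
    using assms(2) by (intro outcome_along_run) (simp add: consistent_runs_iff)
  ultimately show ?thesis
    using reward_along_run[of G r m i] reward_along_run[of G r' m i] assms(3) by simp
qed

lemma ex_other_active_infinitely_often:
  assumes "2 \<le> card {i. active_infinitely_often G i r}"
  obtains j where "j \<noteq> i" and "active_infinitely_often G j r"
proof -
  have "\<not> {i. active_infinitely_often G i r} \<subseteq> {i}"
  proof
    assume "{i. active_infinitely_often G i r} \<subseteq> {i}"
    from card_mono[OF _ this] assms show False
      by simp
  qed
  then show thesis
    using that by auto
qed

lemma switch_profile_on_run:
  "switch_profile s s_hat r \<Omega> i (position_along r k) = s_hat i (position_along r k)"
  by (simp add: switch_profile_def)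

text \<open>If \<open>r'\<close> were outside \<Omega>, an infinitely active player \<open>j\<close>
  other than \<open>i\<close> would be following \<open>s_hat j\<close> all along it, against
  (b).\<close>

lemma unilateral_deviation_in_segment:
  fixes G :: "('i, 'a) past_game"
  assumes "\<Omega> \<in> segments"
    and "2 \<le> card {i. active_infinitely_often G i r'}"
    and "\<And>j. r' \<notin> \<Omega> \<Longrightarrow> active_infinitely_often G j r' \<Longrightarrow> \<not> consistent G j (s_hat j) r'"
    and "\<And>j. j \<noteq> i \<Longrightarrow> consistent G j (switch_profile s s_hat r \<Omega> j) r'"
  shows "r' \<in> \<Omega>"
proof (rule ccontr)
  assume "r' \<notin> \<Omega>"
  obtain j where j: "j \<noteq> i" "active_infinitely_often G j r'"
    using ex_other_active_infinitely_often[OF assms(2)] .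
  have "consistent G j (s_hat j) r'"
    using assms(4)[OF j(1)] \<open>r' \<notin> \<Omega>\<close>
    by (simp add: consistent_def switch_profile_def
        position_along_in_segment_positions_iff[OF assms(1)])
  with j assms(3) \<open>r' \<notin> \<Omega>\<close> show False
    by blast
qed

text \<open>The position is still on \<open>r\<close>, where every player but \<open>i\<close>
  follows \<open>s_hat\<close> and hence, by (a), plays the action of \<open>r\<close>.\<close>

lemma unilateral_deviator_active:
  assumes "r' m \<noteq> r m" and "position_along r m = position_along r' m"
    and "\<And>j. consistent G j (s_hat j) r"
    and "\<And>j. j \<noteq> i \<Longrightarrow> consistent G j (switch_profile s s_hat r \<Omega> j) r'"
  shows "active G (position_along r' m) = i"
proof (rule ccontr)
  let ?j = "active G (position_along r' m)"
  assume "?j \<noteq> i"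
  then have "r' m = switch_profile s s_hat r \<Omega> ?j (position_along r' m)"
    using assms(4)[of ?j] by (simp add: consistent_def)
  also have "\<dots> = s_hat ?j (position_along r m)"
    using assms(2) switch_profile_on_run[of s s_hat r \<Omega> ?j m] by simp
  also have "\<dots> = r m"
    using assms(3)[of ?j] assms(2) by (simp add: consistent_def)
  finally show False
    using assms(1) by simp
qed

text \<open>At the later stage \<open>k\<close> the past contains the action at \<open>m\<close>, so
  the position has left \<open>r\<close> but stays in the segment.\<close>

lemma switch_profile_after_deviation:
  assumes "\<Omega> \<in> segments" and "r' \<in> \<Omega>" and "r' m \<noteq> r m" and "k < m"
  shows "switch_profile s s_hat r \<Omega> j (position_along r' k) = s j (position_along r' k)"
  using assms
  by (auto simp: switch_profile_def position_along_in_segment_positions_iff position_along_eq_iff)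

theorem theorem25:
  fixes G :: "('i::finite, 'a::finite) past_game"
    and s s_hat :: "('i, 'a) profile"
    and r :: "'a run"
    and \<Omega> :: "'a run set"
  assumes "game_with_infinite_past G"
    and "\<And>r'. 2 \<le> card {i. active_infinitely_often G i r'}"
    and "equilibrium G s r"
    and "\<Omega> \<in> segments" and "r \<in> \<Omega>"
    and "\<And>i. consistent G i (s_hat i) r"
    and "\<And>i r'. r' \<notin> \<Omega> \<Longrightarrow> active_infinitely_often G i r' \<Longrightarrow> \<not> consistent G i (s_hat i) r'"
  shows "strong_equilibrium G (switch_profile s s_hat r \<Omega>) \<and>
         consistent_runs G (switch_profile s s_hat r \<Omega>) = {r}"
proof -
  let ?s = "switch_profile s s_hat r \<Omega>"
  have eq: "r \<in> consistent_runs G s"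
    "\<And>k. nash_equilibrium (subgame G (position_along r k)) (induced_profile s (position_along r k))"
    using assms(3) by (simp_all add: equilibrium_def)
  have deviation: "\<exists>m. r' m \<noteq> r m \<and> position_along r m = position_along r' m
      \<and> active G (position_along r' m) = i \<and> r' \<in> \<Omega>"
    if others: "\<And>j. j \<noteq> i \<Longrightarrow> consistent G j (?s j) r'" and "r' \<noteq> r" for i r'
  proof -
    have "r' \<in> \<Omega>"
      using unilateral_deviation_in_segment[OF assms(4) assms(2) assms(7) others] .
    moreover from this obtain k where "position_along r k = position_along r' k"
      using same_segment_class[OF assms(4,5)] by blast
    then obtain m where "r' m \<noteq> r m" "position_along r m = position_along r' m"
      using same_segment_first_difference[OF _ \<open>r' \<noteq> r\<close>] by blast
    ultimately show ?thesis
      using unilateral_deviator_active[OF _ _ assms(6) others, of m] by blast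
  qed
  have "r \<in> consistent_runs G ?s"
    using assms(6) by (simp add: consistent_runs_def consistent_def switch_profile_on_run)
  moreover have "r' = r" if "r' \<in> consistent_runs G ?s" for r'
  proof (rule ccontr)
    assume "r' \<noteq> r"
    \<comment> \<open>Here \<open>undefined\<close> is merely some fixed player; what matters is
      having two distinct ones.\<close>
    obtain i :: 'i where "i \<noteq> undefined"
      using ex_other_active_infinitely_often[OF assms(2)] by blast
    \<comment> \<open>Since all players follow the profile, any \<open>j\<close> can be taken as the
      sole possible deviator.\<close>
    have differs: "\<exists>m. r' m \<noteq> r m \<and> position_along r m = position_along r' m
        \<and> active G (position_along r' m) = j" for j
      using deviation[of j r'] that \<open>r' \<noteq> r\<close> by (auto simp: consistent_runs_def)
    obtain m m' where m: "r' m \<noteq> r m" "position_along r m = position_along r' m"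
        "active G (position_along r' m) = i"
      and m': "r' m' \<noteq> r m'" "position_along r m' = position_along r' m'"
        "active G (position_along r' m') = undefined"
      using differs[of i] differs[of undefined] by blast
    \<comment> \<open>The runs agree before each of the two differences, so neither can precede the
      other.\<close>
    have "m = m'"
      using m(1,2) m'(1,2) by (cases m m' rule: linorder_cases) (auto simp: position_along_eq_iff)
    with m(3) m'(3) \<open>i \<noteq> undefined\<close> show False
      by simp
  qed
  ultimately have runs: "consistent_runs G ?s = {r}"
    by blast
  moreover have "payoff G i r' \<le> payoff G i r" if r': "r' \<in> consistent_runs G (?s(i := t))" for i t r'
  proof (cases "r' = r")
    case False
    have others: "consistent G j (?s j) r'" if "j \<noteq> i" for j
      using r' that by (auto simp: consistent_runs_def dest: spec[of _ j])
    obtain m where m: "r' m \<noteq> r m" "position_along r m = position_along r' m"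
      "active G (position_along r' m) = i" "r' \<in> \<Omega>"
      using deviation[OF others False] by blast
    \<comment> \<open>At \<open>m\<close> the position is on \<open>r\<close>, where the switched
      profile need not agree with \<open>s\<close>; there it helps that \<open>i\<close> moves, so
      that \<open>t\<close> decides. Afterwards the opponents follow \<open>s\<close>.\<close>
    have "r' k = (s(i := t)) (active G (position_along r' k)) (position_along r' k)" if "k \<le> m" for k
    proof (cases "k = m")
      case True
      then show ?thesis
        using r' m(3) by (simp add: consistent_runs_iff)
    next
      case False
      with that have "k < m"
        by simp
      then show ?thesis
        using r' switch_profile_after_deviation[of \<Omega> r' m r k s s_hat]
          assms(4) m(1,4)
        by (simp add: consistent_runs_iff fun_upd_def)
    qed
    then show ?thesis
      by (rule nash_equilibrium_subgame_payoff[OF eq(2,1) m(2)])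
  qed simp
  ultimately show ?thesis
    unfolding strong_equilibrium_def by blast
qed

end
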